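(* In the message-passing model with $s$ players and no edge duplication, the randomized communication complexity of computing an additive $2$-spanner of an $n$-vertex input graph is $\tilde O(\sqrt{s}\, n^{3/2})$ bits.
   Context: Message-passing model: there are $s$ players $P^1,\dots,P^s$ and a coordinator. All parties know the vertex set $V$, $|V|=n$; player $P^i$ holds an edge set $E_i$ on $V$, and the input graph is $G=(V,\bigcup_i E_i)$ (unweighted, undirected). Communication is only between the coordinator and individual players; the coordinator must output the spanner. Communication cost is the total number of bits exchanged; randomized protocols must succeed with constant probability (at least $2/3$) on every input. "No edge duplication" means the $E_i$ are pairwise disjoint. An additive $\beta$-spanner of $G$ is a subgraph $H$ with $d_G(u,v)\le d_H(u,v)\le d_G(u,v)+\beta$ for all $u,v$. $\tilde O$ hides $\mathrm{poly}(\log n)$ factors. Standing assumption: $s\ll n$ (e.g. $s=O(n^{\varepsilon})$ for a small constant $\varepsilon$). *)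

theory Defs
  imports Complex_Main "HOL-Library.Extended_Nat" "HOL-Library.Extended_Real"
    "HOL-Library.Disjoint_Sets" "HOL-Probability.Product_PMF"
begin

section \<open>Graphs on the vertex set \<open>{..<n}\<close>\<close>

text \<open>A graph is given by its set of edges; an edge is a two-element set of vertices.\<close>

type_synonym edges = "nat set set"

definition all_edges :: "nat \<Rightarrow> edges" where
  "all_edges n = {e. e \<subseteq> {..<n} \<and> card e = 2}"

definition walk :: "edges \<Rightarrow> nat \<Rightarrow> nat list \<Rightarrow> nat \<Rightarrow> bool" where
  "walk E u p v \<longleftrightarrow>
     p \<noteq> [] \<and> hd p = u \<and> last p = v \<and> successively (\<lambda>x y. {x, y} \<in> E) p"

text \<open>The infimum of the empty set is \<open>\<infinity>\<close>, the distance of disconnected vertices.\<close>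

definition graph_dist :: "edges \<Rightarrow> nat \<Rightarrow> nat \<Rightarrow> enat" where
  "graph_dist E u v = (INF p \<in> {p. walk E u p v}. enat (length p - 1))"

definition additive_spanner :: "nat \<Rightarrow> nat \<Rightarrow> edges \<Rightarrow> edges \<Rightarrow> bool" where
  "additive_spanner \<beta> n G H \<longleftrightarrow>
     H \<subseteq> G \<and>
     (\<forall>u<n. \<forall>v<n. graph_dist G u v \<le> graph_dist H u v \<and>
                   graph_dist H u v \<le> graph_dist G u v + enat \<beta>)"


section \<open>The message-passing model with a coordinator\<close>

text \<open>
  The players are \<open>0, \<dots>, s - 1\<close>. The coordinator drives the protocol: in each round it either
  stops with an output, or sends a message to one player, who answers. It chooses
  its action from its private coins and everything it has sent and received; a player sees only
  its own input, its own private coins and its own conversation with the coordinator.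
  Public coins are not available. A party may draw its coins from any distribution on \<open>nat\<close>.
\<close>

type_synonym message = "bool list"

datatype 'out action = Query nat message | Output 'out

text \<open>Entries are (player, message of the coordinator, answer of the player), oldest first.\<close>

type_synonym history = "(nat \<times> message \<times> message) list"

record ('in, 'out) protocol =
  coord_coins :: "nat pmf"
  player_coins :: "nat \<Rightarrow> nat pmf"
  coord :: "nat \<Rightarrow> history \<Rightarrow> 'out action"
  player :: "nat \<Rightarrow> 'in \<Rightarrow> nat \<Rightarrow> (message \<times> message) list \<Rightarrow> message \<Rightarrow> message"

text \<open>
  Messages must be nonempty: otherwise the number of empty messages would carry information
  at no cost.
\<close>

definition wf_protocol :: "nat \<Rightarrow> ('in, 'out) protocol \<Rightarrow> bool" where
  "wf_protocol s P \<longleftrightarrow>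
     (\<forall>c h i m. coord P c h = Query i m \<longrightarrow> i < s \<and> m \<noteq> []) \<and>
     (\<forall>i x r l m. player P i x r l m \<noteq> [])"

definition local_view :: "nat \<Rightarrow> history \<Rightarrow> (message \<times> message) list" where
  "local_view i h = map snd (filter (\<lambda>e. fst e = i) h)"

text \<open>
  In the following, \<open>x i\<close> is the input of player \<open>i\<close>, \<open>c\<close> are the coins of the coordinator
  and \<open>r i\<close> those of player \<open>i\<close>.
\<close>

inductive reaches ::
  "('in, 'out) protocol \<Rightarrow> (nat \<Rightarrow> 'in) \<Rightarrow> nat \<Rightarrow> (nat \<Rightarrow> nat) \<Rightarrow> history \<Rightarrow> bool"
  for P x c r where
  start: "reaches P x c r []"
| round: "reaches P x c r h \<Longrightarrow> coord P c h = Query i m \<Longrightarrow>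
    reaches P x c r (h @ [(i, m, player P i (x i) (r i) (local_view i h) m)])"

definition halts ::
  "('in, 'out) protocol \<Rightarrow> (nat \<Rightarrow> 'in) \<Rightarrow> nat \<Rightarrow> (nat \<Rightarrow> nat) \<Rightarrow> history \<Rightarrow> 'out \<Rightarrow> bool"
  where "halts P x c r h y \<longleftrightarrow> reaches P x c r h \<and> coord P c h = Output y"

definition bits :: "history \<Rightarrow> nat" where
  "bits h = (\<Sum>(i, m, a)\<leftarrow>h. length m + length a)"

text \<open>
  A run is determined by inputs and coins, so the set below has at most one element; it is
  empty, and the cost \<open>\<infinity>\<close>, if the run does not halt.
\<close>

definition run_cost ::
  "('in, 'out) protocol \<Rightarrow> (nat \<Rightarrow> 'in) \<Rightarrow> nat \<Rightarrow> (nat \<Rightarrow> nat) \<Rightarrow> enat" where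
  "run_cost P x c r = (INF h \<in> {h. \<exists>y. halts P x c r h y}. enat (bits h))"

definition coins :: "nat \<Rightarrow> ('in, 'out) protocol \<Rightarrow> (nat \<times> (nat \<Rightarrow> nat)) pmf" where
  "coins s P = pair_pmf (coord_coins P) (Pi_pmf {..<s} 0 (player_coins P))"

text \<open>
  \<open>X\<close> is the set of admissible inputs and \<open>R x y\<close> says that \<open>y\<close> is a correct output on \<open>x\<close>.
  The cost is the worst case over inputs and coins.
\<close>

definition comm_cost :: "nat \<Rightarrow> (nat \<Rightarrow> 'in) set \<Rightarrow> ('in, 'out) protocol \<Rightarrow> enat" where
  "comm_cost s X P = (SUP x \<in> X. SUP (c, r) \<in> set_pmf (coins s P). run_cost P x c r)"

definition solves ::
  "nat \<Rightarrow> (nat \<Rightarrow> 'in) set \<Rightarrow> ((nat \<Rightarrow> 'in) \<Rightarrow> 'out \<Rightarrow> bool) \<Rightarrow> ('in, 'out) protocol \<Rightarrow> bool" where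
  "solves s X R P \<longleftrightarrow>
     (\<forall>x\<in>X. measure_pmf.prob (coins s P) {(c, r). \<exists>h y. halts P x c r h y \<and> R x y} \<ge> 2 / 3)"

definition randomized_cc ::
  "nat \<Rightarrow> (nat \<Rightarrow> 'in) set \<Rightarrow> ((nat \<Rightarrow> 'in) \<Rightarrow> 'out \<Rightarrow> bool) \<Rightarrow> enat" where
  "randomized_cc s X R = (INF P \<in> {P. wf_protocol s P \<and> solves s X R P}. comm_cost s X P)"


section \<open>The spanner problem without edge duplication\<close>

definition no_dup_inputs :: "nat \<Rightarrow> nat \<Rightarrow> (nat \<Rightarrow> edges) set" where
  "no_dup_inputs n s = {E. (\<forall>i<s. E i \<subseteq> all_edges n) \<and> disjoint_family_on E {..<s}}"

definition spanner_cc_no_dup :: "nat \<Rightarrow> nat \<Rightarrow> nat \<Rightarrow> enat" where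
  "spanner_cc_no_dup \<beta> n s =
     randomized_cc s (no_dup_inputs n s) (\<lambda>E H. additive_spanner \<beta> n (\<Union>i<s. E i) H)"

end

theory Submission
  imports Defs
begin

text \<open>
  Let \<open>d\<close> be about \<open>sqrt (s n)\<close>. The coordinator goes through the vertices \<open>v\<close> and collects all
  edges from \<open>v\<close> to vertices that are not yet covered. If there are at least \<open>d\<close> of them, \<open>v\<close>
  becomes a centre and these neighbours become covered; hence there are at most \<open>n / d\<close> centres,
  at most \<open>n + n d\<close> edges are collected, and the collected edges contain every edge with an uncovered
  endpoint. Then a breadth-first search is run from every centre, at a cost of \<open>O(s n log n)\<close> bits
  each, and its tree is added to the output. A path of \<open>G\<close> with an edge that was not collected
  passes through a covered vertex, and the detour through the centre next to that vertex, along
  the tree, is longer by at most 2. Both parts cost \<open>O(sqrt s n\<^sup>3\<^sup>/\<^sup>2 log n)\<close> bits, without randomness.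
\<close>

section \<open>Balls and distances\<close>

definition nbhd :: "edges \<Rightarrow> nat set \<Rightarrow> nat set" where
  "nbhd E F = {w. \<exists>p\<in>F. {p, w} \<in> E}"

text \<open>Balls replace the infimum over walks in all later arguments: they grow layer by layer,
  as a breadth-first search does. The link is \<open>graph_dist_le_iff\<close>.\<close>

primrec ball_of :: "edges \<Rightarrow> nat \<Rightarrow> nat \<Rightarrow> nat set" where
  "ball_of E u 0 = {u}"
| "ball_of E u (Suc k) = ball_of E u k \<union> nbhd E (ball_of E u k)"

lemma nbhd_mono: "E \<subseteq> E' \<Longrightarrow> F \<subseteq> F' \<Longrightarrow> nbhd E F \<subseteq> nbhd E' F'"
  unfolding nbhd_def by blast

lemma ball_of_mono: "E \<subseteq> E' \<Longrightarrow> ball_of E u k \<subseteq> ball_of E' u k"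
proof (induction k)
  case (Suc k)
  then show ?case using nbhd_mono[OF Suc.prems Suc.IH[OF Suc.prems]] by auto
qed simp

lemma ball_of_le: "k \<le> l \<Longrightarrow> ball_of E u k \<subseteq> ball_of E u l"
  by (induction l rule: dec_induct) auto

lemma ball_of_trans:
  "v \<in> ball_of E u k \<Longrightarrow> w \<in> ball_of E v l \<Longrightarrow> w \<in> ball_of E u (k + l)"
  by (induction l arbitrary: w) (auto simp: nbhd_def)

lemma ball_of_edge: "{x, y} \<in> E \<Longrightarrow> y \<in> ball_of E x 1"
  by (auto simp: nbhd_def)

lemma ball_of_sym: "v \<in> ball_of E u k \<Longrightarrow> u \<in> ball_of E v k"
proof (induction k arbitrary: v)
  case (Suc k)
  show ?case
  proof (cases "v \<in> ball_of E u k")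
    case True
    then show ?thesis using Suc.IH by auto
  next
    case False
    then obtain x where x: "x \<in> ball_of E u k" "{x, v} \<in> E"
      using Suc.prems by (auto simp: nbhd_def)
    then have "x \<in> ball_of E v 1" using ball_of_edge[of v x] by (simp add: insert_commute)
    from ball_of_trans[OF this Suc.IH[OF x(1)]] show ?thesis by simp
  qed
qed simp

lemma walk_imp_ball_of: "walk E u p v \<Longrightarrow> v \<in> ball_of E u (length p - 1)"
proof (induction p arbitrary: v rule: rev_induct)
  case (snoc x p)
  show ?case
  proof (cases "p = []")
    case True
    then show ?thesis using snoc.prems by (simp add: walk_def)
  next
    case False
    then have w: "walk E u p (last p)" "{last p, v} \<in> E"
      using snoc.prems by (auto simp: walk_def successively_append_iff)
    have "v \<in> ball_of E u (Suc (length p - 1))"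
      using snoc.IH[OF w(1)] w(2) by (auto simp: nbhd_def)
    then show ?thesis using False by simp
  qed
qed (simp add: walk_def)

lemma ball_of_imp_walk: "v \<in> ball_of E u k \<Longrightarrow> \<exists>p. walk E u p v \<and> length p - 1 \<le> k"
proof (induction k arbitrary: v)
  case 0
  then show ?case by (intro exI[of _ "[u]"]) (auto simp: walk_def)
next
  case (Suc k)
  show ?case
  proof (cases "v \<in> ball_of E u k")
    case True
    then show ?thesis using Suc.IH le_SucI by blast
  next
    case False
    then obtain x where x: "x \<in> ball_of E u k" "{x, v} \<in> E"
      using Suc.prems by (auto simp: nbhd_def)
    from Suc.IH[OF x(1)] obtain p where "walk E u p x" "length p - 1 \<le> k" by blast
    then have "walk E u (p @ [v]) v \<and> length (p @ [v]) - 1 \<le> Suc k"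
      using x(2) by (auto simp: walk_def successively_append_iff)
    then show ?thesis by blast
  qed
qed

text \<open>A finite bound excludes an empty set of walks, and a nonempty set in \<open>enat\<close>
  attains its infimum, so a shortest walk exists.\<close>

lemma graph_dist_le_iff: "graph_dist E u v \<le> enat k \<longleftrightarrow> v \<in> ball_of E u k"
proof
  assume le: "graph_dist E u v \<le> enat k"
  let ?S = "(\<lambda>p. enat (length p - 1)) ` {p. walk E u p v}"
  have "?S \<noteq> {}"
  proof
    assume "?S = {}"
    then have "graph_dist E u v = \<infinity>" by (simp only: graph_dist_def Inf_enat_def simp_thms if_True)
    then show False using le by simp
  qed
  then have "Inf ?S \<in> ?S"
    by (metis (mono_tags, lifting) Inf_enat_def LeastI equals0I)
  then obtain p where p: "walk E u p v" "graph_dist E u v = enat (length p - 1)"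
    unfolding graph_dist_def by auto
  then show "v \<in> ball_of E u k"
    using walk_imp_ball_of[OF p(1)] ball_of_le[of "length p - 1" k E u] le by auto
next
  assume "v \<in> ball_of E u k"
  then obtain p where p: "walk E u p v" "length p - 1 \<le> k" using ball_of_imp_walk by blast
  have "graph_dist E u v \<le> enat (length p - 1)"
    unfolding graph_dist_def using p(1) by (intro INF_lower) auto
  also have "\<dots> \<le> enat k" using p(2) by simp
  finally show "graph_dist E u v \<le> enat k" .
qed

section \<open>Sufficient conditions for additive spanners\<close>

lemma additive_spannerI:
  assumes "H \<subseteq> G"
    and "\<And>u v k. u < n \<Longrightarrow> v < n \<Longrightarrow> v \<in> ball_of G u k \<Longrightarrow> v \<in> ball_of H u (k + \<beta>)"
  shows "additive_spanner \<beta> n G H"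
  unfolding additive_spanner_def
proof (intro conjI allI impI)
  fix u v assume uv: "u < n" "v < n"
  show "graph_dist G u v \<le> graph_dist H u v"
  proof (cases "graph_dist H u v")
    case (enat k)
    then have "v \<in> ball_of H u k" using graph_dist_le_iff[of H u v k] by simp
    then have "v \<in> ball_of G u k" using ball_of_mono[OF assms(1)] by blast
    then show ?thesis using graph_dist_le_iff[of G u v k] enat by simp
  qed simp
  show "graph_dist H u v \<le> graph_dist G u v + enat \<beta>"
  proof (cases "graph_dist G u v")
    case (enat k)
    then have "v \<in> ball_of G u k" using graph_dist_le_iff[of G u v k] by simp
    then show ?thesis
      using assms(2)[OF uv] graph_dist_le_iff[of H u v "k + \<beta>"] enat by simp
  qed simp
qed (rule assms(1))

text \<open>An edge of \<open>G\<close> missing from \<open>H\<close> has both ends in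
  \<open>K\<close>, so a walk that does not survive in \<open>H\<close> can be split at some
  \<open>a\<close> in \<open>K\<close>. With \<open>c\<close> a centre adjacent to \<open>a\<close>,
  the ends of the walk lie within \<open>1 + k1\<close> and \<open>1 + k2\<close> of
  \<open>c\<close>, and \<open>H\<close> preserves these bounds; the two steps between
  \<open>c\<close> and \<open>a\<close> are the additive 2.\<close>

lemma spanner_from_centres:
  assumes "H \<subseteq> G" and "G \<subseteq> all_edges n"
    and sparse: "\<And>v w. {v, w} \<in> G \<Longrightarrow> w \<notin> K \<Longrightarrow> {v, w} \<in> H"
    and covered: "\<And>w. w \<in> K \<Longrightarrow> \<exists>c\<in>C. {c, w} \<in> G"
    and trees: "\<And>c j. c \<in> C \<Longrightarrow> ball_of G c j \<subseteq> ball_of H c j"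
  shows "additive_spanner 2 n G H"
proof (rule additive_spannerI[OF assms(1)])
  fix u v k assume "v \<in> ball_of G u k"
  then have "v \<in> ball_of H u k \<or>
      (\<exists>a\<in>K. \<exists>k1 k2. k1 + k2 = k \<and> a \<in> ball_of G u k1 \<and> v \<in> ball_of G a k2)"
  proof (induction k arbitrary: v)
    case (Suc k)
    then consider "v \<in> ball_of G u k" | x where "x \<in> ball_of G u k" "{x, v} \<in> G"
      by (auto simp: nbhd_def)
    then show ?case
    proof cases
      case 1
      from Suc.IH[OF this] show ?thesis
      proof
        assume "\<exists>a\<in>K. \<exists>k1 k2. k1 + k2 = k \<and> a \<in> ball_of G u k1 \<and> v \<in> ball_of G a k2"
        then obtain a k1 k2 where "a \<in> K" "k1 + k2 = k" "a \<in> ball_of G u k1" "v \<in> ball_of G a k2"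
          by blast
        then have "k1 + Suc k2 = Suc k" "v \<in> ball_of G a (Suc k2)" by auto
        with \<open>a \<in> K\<close> \<open>a \<in> ball_of G u k1\<close> show ?thesis by blast
      qed simp
    next
      case 2
      from Suc.IH[OF 2(1)] show ?thesis
      proof
        assume x: "x \<in> ball_of H u k"
        show ?thesis
        proof (cases "{x, v} \<in> H")
          case True
          then show ?thesis using x by (auto simp: nbhd_def)
        next
          case False
          then have "x \<in> K" using sparse[of v x] 2(2) by (auto simp: insert_commute)
          moreover have "v \<in> ball_of G x 1" using 2(2) ball_of_edge by simp
          ultimately show ?thesis using 2(1) by (metis Suc_eq_plus1)
        qed
      next
        assume "\<exists>a\<in>K. \<exists>k1 k2. k1 + k2 = k \<and> a \<in> ball_of G u k1 \<and> x \<in> ball_of G a k2"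
        then obtain a k1 k2 where "a \<in> K" "k1 + k2 = k" "a \<in> ball_of G u k1" "x \<in> ball_of G a k2"
          by blast
        then have "k1 + Suc k2 = Suc k" "v \<in> ball_of G a (Suc k2)"
          using 2(2) by (auto simp: nbhd_def)
        with \<open>a \<in> K\<close> \<open>a \<in> ball_of G u k1\<close> show ?thesis by blast
      qed
    qed
  qed simp
  then show "v \<in> ball_of H u (k + 2)"
  proof
    assume "v \<in> ball_of H u k"
    then show ?thesis using ball_of_le[of k "k + 2" H u] by auto
  next
    assume "\<exists>a\<in>K. \<exists>k1 k2. k1 + k2 = k \<and> a \<in> ball_of G u k1 \<and> v \<in> ball_of G a k2"
    then obtain a k1 k2 where a: "a \<in> K" "k1 + k2 = k" "a \<in> ball_of G u k1" "v \<in> ball_of G a k2"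
      by blast
    from covered[OF a(1)] obtain c where c: "c \<in> C" "{c, a} \<in> G" by blast
    have ca: "a \<in> ball_of G c 1" using c(2) ball_of_edge by simp
    have "u \<in> ball_of G c (1 + k1)" "v \<in> ball_of G c (1 + k2)"
      using ball_of_trans[OF ca ball_of_sym[OF a(3)]] ball_of_trans[OF ca a(4)] by auto
    then have "u \<in> ball_of H c (1 + k1)" "v \<in> ball_of H c (1 + k2)"
      using trees[OF c(1)] by blast+
    from ball_of_trans[OF ball_of_sym[OF this(1)] this(2)]
    have "v \<in> ball_of H u ((1 + k1) + (1 + k2))" .
    moreover have "(1 + k1) + (1 + k2) = k + 2" using a(2) by simp
    ultimately show ?thesis by (simp only:)
  qed
qed

section \<open>Encoding finite sets by bit strings\<close>

text \<open>Codewords of fixed length \<open>L\<close> are concatenated, so the total length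
  determines their number and the string can be cut up again. The leading bit keeps the code of the
  empty set nonempty, as messages must be.\<close>

lemma set_encoding_exists:
  fixes \<Sigma> :: "'a set"
  assumes fin: "finite \<Sigma>" and card: "card \<Sigma> \<le> 2 ^ L" and L: "0 < L"
  obtains enc :: "'a set \<Rightarrow> bool list"
  where "inj_on enc (Pow \<Sigma>)" and "\<And>A. enc A \<noteq> []"
    and "\<And>A. A \<subseteq> \<Sigma> \<Longrightarrow> length (enc A) = 1 + L * card A"
proof -
  have "finite {xs :: bool list. length xs = L}"
    using finite_lists_length_eq[of "UNIV :: bool set" L] by simp
  moreover have "card {xs :: bool list. length xs = L} = 2 ^ L"
    using card_lists_length_eq[of "UNIV :: bool set" L] by simp
  ultimately obtain code :: "'a \<Rightarrow> bool list"
    where code: "code ` \<Sigma> \<subseteq> {xs. length xs = L}" "inj_on code \<Sigma>"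
    using card_le_inj[OF fin] card by metis
  define lst where "lst A = (SOME xs. set xs = A \<and> distinct xs)" for A :: "'a set"
  have lst: "set (lst A) = A" "distinct (lst A)" if "A \<subseteq> \<Sigma>" for A
    using someI_ex[OF finite_distinct_list[OF finite_subset[OF that fin]]]
    unfolding lst_def by auto
  define enc where "enc A = True # concat (map code (lst A))" for A
  have len: "length (concat (map code xs)) = L * length xs" if "set xs \<subseteq> \<Sigma>" for xs
    using that code(1) by (induction xs) auto
  show ?thesis
  proof (rule that[of enc])
    show "inj_on enc (Pow \<Sigma>)"
    proof (rule inj_onI)
      fix A B assume AB: "A \<in> Pow \<Sigma>" "B \<in> Pow \<Sigma>" "enc A = enc B"
      then have eq: "concat (map code (lst A)) = concat (map code (lst B))"
        by (simp add: enc_def)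
      have sub: "set (lst A) \<subseteq> \<Sigma>" "set (lst B) \<subseteq> \<Sigma>" using AB lst by auto
      from arg_cong[OF eq, of length] have "length (lst A) = length (lst B)"
        using len sub L by simp
      then have "map code (lst A) = map code (lst B)"
      proof (intro concat_injective[OF eq] ballI)
        fix z assume z: "z \<in> set (zip (map code (lst A)) (map code (lst B)))"
        obtain x y where xy: "z = (x, y)" by (cases z)
        then have "x \<in> code ` \<Sigma>" "y \<in> code ` \<Sigma>"
          using z sub set_zip_leftD[of x y] set_zip_rightD[of x y] by fastforce+
        then show "case z of (x, y) \<Rightarrow> length x = length y" using code(1) xy by auto
      qed simp
      then have "lst A = lst B"
        using map_inj_on inj_on_subset[OF code(2)] sub by (metis Un_least)
      then show "A = B" using lst AB by (metis PowD)
    qed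
    show "enc A \<noteq> []" for A by (simp add: enc_def)
    show "length (enc A) = 1 + L * card A" if "A \<subseteq> \<Sigma>" for A
      using len[of "lst A"] lst[OF that] that distinct_card[of "lst A"] by (simp add: enc_def)
  qed
qed

section \<open>Broadcast programs\<close>

text \<open>The coordinator sends one message to all players; the continuation is applied to the
  union of their answers.\<close>

datatype ('m, 'a, 'out) prog =
  Return 'out
| Bcast "'m set" "'a set \<Rightarrow> ('m, 'a, 'out) prog"

text \<open>All players hear the same broadcasts, so they share a state that depends on no input. It
  starts as \<open>k0\<close> and is changed by \<open>upd\<close> at each message;
  \<open>ans\<close> computes an answer from the state after the update.\<close>

locale broadcast =
  fixes s L :: nat
    and \<Sigma>m :: "'m set" and \<Sigma>a :: "'a set"
    and encm :: "'m set \<Rightarrow> message" and enca :: "'a set \<Rightarrow> message"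
    and upd :: "'k \<Rightarrow> 'm set \<Rightarrow> 'k" and k0 :: 'k
    and ans :: "'in \<Rightarrow> 'k \<Rightarrow> 'm set \<Rightarrow> 'a set"
  assumes s_pos: "0 < s"
    and encm_inj: "inj_on encm (Pow \<Sigma>m)" and enca_inj: "inj_on enca (Pow \<Sigma>a)"
    and encm_ne: "encm M \<noteq> []" and enca_ne: "enca A \<noteq> []"
    and encm_len: "M \<subseteq> \<Sigma>m \<Longrightarrow> length (encm M) = 1 + L * card M"
    and enca_len: "A \<subseteq> \<Sigma>a \<Longrightarrow> length (enca A) = 1 + L * card A"
begin

definition decm :: "message \<Rightarrow> 'm set" where "decm = inv_into (Pow \<Sigma>m) encm"
definition deca :: "message \<Rightarrow> 'a set" where "deca = inv_into (Pow \<Sigma>a) enca"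

lemma decm_encm: "M \<subseteq> \<Sigma>m \<Longrightarrow> decm (encm M) = M"
  unfolding decm_def using encm_inj by (simp add: inv_into_f_f)

lemma deca_enca: "A \<subseteq> \<Sigma>a \<Longrightarrow> deca (enca A) = A"
  unfolding deca_def using enca_inj by (simp add: inv_into_f_f)

text \<open>An incomplete last round of answers is ignored.\<close>

primrec residual :: "('m, 'a, 'out) prog \<Rightarrow> message list \<Rightarrow> ('m, 'a, 'out) prog" where
  "residual (Return y) = (\<lambda>as. Return y)"
| "residual (Bcast M f) = (\<lambda>as. if length as < s then Bcast M f
     else residual (f (\<Union>(deca ` set (take s as)))) (drop s as))"

text \<open>A broadcast is serialised in cyclic order of the players, and the length of the history
  modulo \<open>s\<close> tells whose turn it is. A player has no memory, so it replays its view and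
  the current message to recover the shared state.\<close>

definition protocol_of :: "('m, 'a, 'out) prog \<Rightarrow> ('in, 'out) protocol" where
  "protocol_of p =
    \<lparr> coord_coins = return_pmf 0,
      player_coins = (\<lambda>_. return_pmf 0),
      coord = (\<lambda>_ h. case residual p (map (snd \<circ> snd) h) of
                 Return y \<Rightarrow> Output y
               | Bcast M f \<Rightarrow> Query (length h mod s) (encm M)),
      player = (\<lambda>_ x _ l m.
        enca (ans x (foldl upd k0 (map (decm \<circ> fst) l @ [decm m])) (decm m))) \<rparr>"

text \<open>A weakest precondition with a bound \<open>c\<close> on the bits still to be exchanged: in a round every
  player receives and sends one bit plus \<open>L\<close> bits per element of the message and of the answer.\<close>

primrec guarantees ::
  "(nat \<Rightarrow> 'in) \<Rightarrow> ('out \<Rightarrow> bool) \<Rightarrow> ('m, 'a, 'out) prog \<Rightarrow> 'k \<Rightarrow> nat \<Rightarrow> bool" where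
  "guarantees x Q (Return y) = (\<lambda>k c. Q y)"
| "guarantees x Q (Bcast M f) = (\<lambda>k c. M \<subseteq> \<Sigma>m \<and> (\<forall>i<s. ans (x i) (upd k M) M \<subseteq> \<Sigma>a) \<and>
     (\<exists>c'. s * (2 + L * card M) + L * (\<Sum>i<s. card (ans (x i) (upd k M) M)) + c' \<le> c \<and>
        guarantees x Q (f (\<Union>i<s. ans (x i) (upd k M) M)) (upd k M) c'))"

lemma guarantees_mono: "guarantees x Q p k c \<Longrightarrow> c \<le> c' \<Longrightarrow> guarantees x Q p k c'"
  by (cases p) (auto intro: order_trans)

text \<open>Answers of complete rounds can be consumed first. For a partial round this would fail,
  because \<open>residual\<close> drops its answers.\<close>

lemma residual_append:
  "s dvd length as \<Longrightarrow> residual p (as @ bs) = residual (residual p as) bs"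
proof (induction p arbitrary: as)
  case (Bcast M f)
  show ?case
  proof (cases "length as < s")
    case True
    then have "as = []" using Bcast.prems by (auto dest: dvd_imp_le)
    then show ?thesis using s_pos by simp
  next
    case False
    then have "s dvd length (drop s as)" using Bcast.prems by (simp add: dvd_diff_nat)
    then show ?thesis using False Bcast.IH by simp
  qed
qed simp

lemma wf_protocol_of: "wf_protocol s (protocol_of p)"
  unfolding wf_protocol_def protocol_of_def
  using s_pos encm_ne enca_ne by (auto split: prog.splits)

lemma local_view_round:
  "local_view i (h @ map (\<lambda>j. (j, m, a j)) [0..<t]) =
    local_view i h @ (if i < t then [(m, a i)] else [])"
  by (induction t) (auto simp: local_view_def less_Suc_eq)

text \<open>Induction on the number \<open>t\<close> of players already asked. The incomplete round
  is ignored by \<open>residual\<close>, so the coordinator still stands at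
  \<open>Bcast M f\<close>, and player \<open>t\<close> still has its old view.\<close>

lemma reaches_round:
  assumes reach: "reaches (protocol_of p) x c r h"
    and dvd: "s dvd length h"
    and res: "residual p (map (snd \<circ> snd) h) = Bcast M f"
    and view: "\<And>i. i < s \<Longrightarrow> map (decm \<circ> fst) (local_view i h) = ms"
    and M: "M \<subseteq> \<Sigma>m" and k: "k = foldl upd k0 (ms @ [M])"
    and "t \<le> s"
  shows "reaches (protocol_of p) x c r
    (h @ map (\<lambda>i. (i, encm M, enca (ans (x i) k M))) [0..<t])"
  using \<open>t \<le> s\<close>
proof (induction t)
  case 0
  then show ?case using reach by simp
next
  case (Suc t)
  let ?h = "h @ map (\<lambda>i. (i, encm M, enca (ans (x i) k M))) [0..<t]"
  have "t < s" using Suc.prems by simp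
  have "residual p (map (snd \<circ> snd) ?h) = Bcast M f"
    using residual_append[of "map (snd \<circ> snd) h" p] dvd res \<open>t < s\<close> by simp
  moreover have "length ?h mod s = t"
    using dvd \<open>t < s\<close> by (auto elim!: dvdE)
  ultimately have q: "coord (protocol_of p) c ?h = Query t (encm M)"
    by (simp add: protocol_of_def)
  have lv: "local_view t ?h = local_view t h"
    using local_view_round[of t h "encm M" "\<lambda>i. enca (ans (x i) k M)" t] by simp
  have "player (protocol_of p) t (x t) (r t) (local_view t ?h) (encm M) = enca (ans (x t) k M)"
    unfolding lv using view[OF \<open>t < s\<close>] k by (simp add: protocol_of_def decm_encm[OF M])
  then show ?case
    using reaches.round[OF Suc.IH q] \<open>t < s\<close> by simp
qed

lemma bits_round:
  "bits (h @ map (\<lambda>i. (i, m, a i)) [0..<t]) = bits h + t * length m + (\<Sum>i<t. length (a i))"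
  by (induction t) (auto simp: bits_def)

text \<open>Soundness of the simulation, by induction on the program that remains after complete
  rounds: \<open>ms\<close> lists the messages broadcast so far, seen alike by every player, and the
  induction step appends one whole round.\<close>

lemma guarantees_halts:
  assumes "reaches (protocol_of p) x c r h"
    and "s dvd length h"
    and "residual p (map (snd \<circ> snd) h) = q"
    and "\<And>i. i < s \<Longrightarrow> map (decm \<circ> fst) (local_view i h) = ms"
    and "guarantees x Q q (foldl upd k0 ms) b"
  shows "\<exists>h' y. halts (protocol_of p) x c r h' y \<and> bits h' \<le> bits h + b \<and> Q y"
  using assms
proof (induction q arbitrary: h ms b)
  case (Return y)
  then have "halts (protocol_of p) x c r h y"
    by (simp only: halts_def protocol_of_def protocol.simps prog.case simp_thms)
  moreover have "Q y" using Return.prems(5) by simp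
  ultimately show ?case using le_add1 by blast
next
  case (Bcast M f)
  define k where "k = foldl upd k0 (ms @ [M])"
  from Bcast.prems(5) obtain b' where M: "M \<subseteq> \<Sigma>m"
    and A: "\<And>i. i < s \<Longrightarrow> ans (x i) k M \<subseteq> \<Sigma>a"
    and b': "s * (2 + L * card M) + L * (\<Sum>i<s. card (ans (x i) k M)) + b' \<le> b"
    and g: "guarantees x Q (f (\<Union>i<s. ans (x i) k M)) k b'"
    by (auto simp: k_def)
  let ?h = "h @ map (\<lambda>i. (i, encm M, enca (ans (x i) k M))) [0..<s]"
  have "bits ?h = bits h + s * length (encm M) + (\<Sum>i<s. length (enca (ans (x i) k M)))"
    by (rule bits_round)
  also have "(\<Sum>i<s. length (enca (ans (x i) k M))) = (\<Sum>i<s. 1 + L * card (ans (x i) k M))"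
    using A enca_len by (intro sum.cong) auto
  also have "\<dots> = s + L * (\<Sum>i<s. card (ans (x i) k M))"
    by (simp only: sum.distrib sum_distrib_left) simp
  finally have bits: "bits ?h + b' \<le> bits h + b"
    using b' encm_len[OF M] by (simp add: algebra_simps)
  have reach: "reaches (protocol_of p) x c r ?h"
    by (rule reaches_round[OF Bcast.prems(1-4) M k_def order_refl])
  have dvd: "s dvd length ?h" using Bcast.prems(2) by simp
  have res: "residual p (map (snd \<circ> snd) ?h) = f (\<Union>i<s. ans (x i) k M)"
  proof -
    have "\<Union>(deca ` (\<lambda>i. enca (ans (x i) k M)) ` {0..<s}) = (\<Union>i<s. ans (x i) k M)"
      using A deca_enca by auto
    \<comment> \<open>\<open>residual\<close> leaves a program unchanged on no answers, but this
      needs the case distinction on the program and \<open>0 < s\<close>.\<close>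
    then show ?thesis
      using residual_append[of "map (snd \<circ> snd) h" p] Bcast.prems(2,3)
      by (cases "f (\<Union>i<s. ans (x i) k M)") (simp_all add: comp_def s_pos)
  qed
  have view: "map (decm \<circ> fst) (local_view i ?h) = ms @ [M]" if "i < s" for i
  proof -
    have "map (decm \<circ> fst) (local_view i ?h) = map (decm \<circ> fst) (local_view i h) @ [decm (encm M)]"
      using that by (simp add: local_view_round)
    then show ?thesis by (simp only: Bcast.prems(4)[OF that] decm_encm[OF M])
  qed
  have "guarantees x Q (f (\<Union>i<s. ans (x i) k M)) (foldl upd k0 (ms @ [M])) b'"
    using g by (simp add: k_def)
  from Bcast.IH[OF rangeI reach dvd res view this]
  have "\<exists>h' y. halts (protocol_of p) x c r h' y \<and> bits h' \<le> bits ?h + b' \<and> Q y" by blast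
  then show ?case using bits by (meson order_trans)
qed

text \<open>The run halts with a correct output for all values of the coins, so the success
  probability is 1 and one bound covers the worst case.\<close>

lemma randomized_cc_le:
  assumes "\<And>x. x \<in> X \<Longrightarrow> guarantees x (R x) p k0 b"
  shows "randomized_cc s X R \<le> enat b"
proof -
  have run: "\<exists>h y. halts (protocol_of p) x c r h y \<and> bits h \<le> b \<and> R x y" if "x \<in> X" for x c r
    using guarantees_halts[of p x c r "[]" _ "[]", OF reaches.start] assms[OF that]
    by (cases p) (fastforce simp: local_view_def bits_def s_pos)+
  have "solves s X R (protocol_of p)"
    unfolding solves_def
  proof
    fix x assume "x \<in> X"
    then have "{(c, r). \<exists>h y. halts (protocol_of p) x c r h y \<and> R x y} = UNIV"
      using run by blast
    then show "measure_pmf.prob (coins s (protocol_of p))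
        {(c, r). \<exists>h y. halts (protocol_of p) x c r h y \<and> R x y} \<ge> 2 / 3"
      by simp
  qed
  then have "randomized_cc s X R \<le> comm_cost s X (protocol_of p)"
    unfolding randomized_cc_def using wf_protocol_of by (intro INF_lower) auto
  also have "\<dots> \<le> enat b"
    unfolding comm_cost_def
  proof (intro SUP_least, clarify)
    fix x c r assume "x \<in> X"
    from run[OF this, of c r] obtain h y
      where hy: "halts (protocol_of p) x c r h y" "bits h \<le> b" by blast
    have "run_cost (protocol_of p) x c r \<le> enat (bits h)"
      unfolding run_cost_def using hy(1) by (intro INF_lower) auto
    also have "\<dots> \<le> enat b" using hy(2) by simp
    finally show "run_cost (protocol_of p) x c r \<le> enat b" .
  qed
  finally show ?thesis .
qed

end

section \<open>The spanner protocol\<close>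

text \<open>A player answers a probe with only one edge per vertex it does not know yet, so that an
  answer is never longer than the list of newly discovered vertices.\<close>

datatype op = Reset | Mark nat | Probe nat

definition ops :: "nat \<Rightarrow> op set" where
  "ops n = {Reset} \<union> Mark ` {..<n} \<union> Probe ` {..<n}"

text \<open>The players' state is the set of vertices they leave out of their reports: covered
  vertices during \<open>scan\<close>, vertices of the current tree during \<open>grow\<close>.
  \<open>Reset\<close> acts before the marks and separates successive uses.\<close>

definition learn :: "nat set \<Rightarrow> op set \<Rightarrow> nat set" where
  "learn K M = (if Reset \<in> M then {} else K) \<union> {w. Mark w \<in> M}"

definition report :: "edges \<Rightarrow> nat set \<Rightarrow> op set \<Rightarrow> edges" where
  "report E K M = (let F = {v. Probe v \<in> M} in
     (\<lambda>w. {SOME p. p \<in> F \<and> {p, w} \<in> E, w}) ` (nbhd E F - K))"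

text \<open>\<open>F\<close> is the last layer of the search and \<open>K\<close> the set of
  vertices reached; the players learn of \<open>F\<close> only with the next probe. The number of
  rounds is fixed in advance, so rounds with an empty frontier may occur, at \<open>2 * s\<close>
  bits each.\<close>

primrec grow :: "nat \<Rightarrow> nat set \<Rightarrow> nat set \<Rightarrow> edges \<Rightarrow> (edges \<Rightarrow> (op, nat set, edges) prog) \<Rightarrow>
    (op, nat set, edges) prog" where
  "grow 0 F K H g = g H"
| "grow (Suc t) F K H g = Bcast (Mark ` F \<union> Probe ` F)
     (\<lambda>A. grow t (nbhd A F - K) (K \<union> (nbhd A F - K)) (H \<union> A) g)"

primrec trees :: "nat \<Rightarrow> nat list \<Rightarrow> edges \<Rightarrow> (op, nat set, edges) prog" where
  "trees n [] H = Return H"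
| "trees n (c # cs) H = Bcast {Reset} (\<lambda>_. grow n {c} {c} H (trees n cs))"

text \<open>\<open>D\<close> is the part of the covered set \<open>K\<close> that the players have not been told yet.\<close>

primrec scan :: "nat \<Rightarrow> nat \<Rightarrow> nat list \<Rightarrow> nat set \<Rightarrow> nat set \<Rightarrow> nat list \<Rightarrow> edges \<Rightarrow>
    (op, nat set, edges) prog" where
  "scan n d [] D K cs H = trees n cs H"
| "scan n d (v # vs) D K cs H = Bcast (Mark ` D \<union> Probe ` {v})
     (\<lambda>A. let N = nbhd A {v} - K in
        if d \<le> card N then scan n d vs N (K \<union> N) (v # cs) (H \<union> A)
        else scan n d vs {} K cs (H \<union> A))"

section \<open>Neighbourhoods and the report of a single player\<close>

lemma nbhd_UN: "nbhd (\<Union>i\<in>I. E i) F = (\<Union>i\<in>I. nbhd (E i) F)"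
  unfolding nbhd_def by blast

lemma nbhd_Un: "nbhd E (F \<union> F') = nbhd E F \<union> nbhd E F'"
  unfolding nbhd_def by blast

lemma nbhd_bounded: "E \<subseteq> all_edges n \<Longrightarrow> nbhd E F \<subseteq> {..<n}"
  unfolding nbhd_def all_edges_def by auto

lemma finite_all_edges: "finite (all_edges n)"
  by (rule finite_subset[of _ "Pow {..<n}"]) (auto simp: all_edges_def)

lemma report_parent:
  assumes "w \<in> nbhd E F"
  defines "p \<equiv> SOME p. p \<in> F \<and> {p, w} \<in> E"
  shows "p \<in> F" "{p, w} \<in> E"
  using someI_ex[of "\<lambda>p. p \<in> F \<and> {p, w} \<in> E"] assms(1) unfolding p_def nbhd_def by auto

lemma report_eq:
  "report E K (Mark ` D \<union> Probe ` F) =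
    (\<lambda>w. {SOME p. p \<in> F \<and> {p, w} \<in> E, w}) ` (nbhd E F - K)"
proof -
  have "{v. Probe v \<in> Mark ` D \<union> Probe ` F} = F" by auto
  then show ?thesis by (simp add: report_def)
qed

lemma report_subset: "report E K M \<subseteq> E"
  using report_parent(2) unfolding report_def Let_def by fastforce

lemma report_Reset: "report E K {Reset} = {}"
  by (simp add: report_def nbhd_def)

lemma card_report_le:
  assumes "E \<subseteq> all_edges n"
  shows "card (report E K (Mark ` D \<union> Probe ` F)) \<le> card (nbhd E F - K)"
  unfolding report_eq using finite_subset[OF nbhd_bounded[OF assms]]
  by (intro card_image_le) auto

text \<open>One parent per vertex is enough for the search: the thinned answer still leads to every
  new neighbour of \<open>F\<close>.\<close>

lemma nbhd_report: "nbhd (report E K (Mark ` D \<union> Probe ` F)) F - K = nbhd E F - K"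
proof
  show "nbhd (report E K (Mark ` D \<union> Probe ` F)) F - K \<subseteq> nbhd E F - K"
    using nbhd_mono[OF report_subset order_refl] by blast
  show "nbhd E F - K \<subseteq> nbhd (report E K (Mark ` D \<union> Probe ` F)) F - K"
    unfolding report_eq using report_parent(1) by (fastforce simp: nbhd_def)
qed

text \<open>With \<open>v\<close> as the only probe the chosen parent must be \<open>v\<close>, so
  thinning loses no edge from \<open>v\<close> to an unknown vertex.\<close>

lemma report_single: "{v, w} \<in> E \<Longrightarrow> w \<notin> K \<Longrightarrow> {v, w} \<in> report E K (Mark ` D \<union> Probe ` {v})"
proof -
  assume vw: "{v, w} \<in> E" "w \<notin> K"
  then have w: "w \<in> nbhd E {v}" by (simp add: nbhd_def)
  then have "(SOME p. p \<in> {v} \<and> {p, w} \<in> E) = v" using report_parent(1)[OF w] by blast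
  then show ?thesis unfolding report_eq using w vw(2) by (intro image_eqI[of _ _ w]) auto
qed

section \<open>The reports of all players and the analysis for a fixed input\<close>

locale spanner_protocol =
  broadcast s L "ops n" "all_edges n" encm enca learn "{}" report
  for s L n :: nat and encm enca +
  fixes E :: "nat \<Rightarrow> edges" and d :: nat
  assumes E_edges: "\<And>i. i < s \<Longrightarrow> E i \<subseteq> all_edges n"
    and E_disjoint: "disjoint_family_on E {..<s}"
    and d_pos: "0 < d"
begin

definition G :: edges where "G = (\<Union>i<s. E i)"

lemma G_edges: "G \<subseteq> all_edges n"
  unfolding G_def using E_edges by auto

lemma finite_nbhd: "finite (nbhd G F)"
  using finite_subset[OF nbhd_bounded[OF G_edges]] by simp

definition reports :: "nat set \<Rightarrow> op set \<Rightarrow> edges" where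
  "reports K M = (\<Union>i<s. report (E i) K M)"

lemma reports_subset: "reports K M \<subseteq> G"
  unfolding reports_def G_def by (intro UN_mono order_refl report_subset)

lemma nbhd_reports: "nbhd (reports K (Mark ` D \<union> Probe ` F)) F - K = nbhd G F - K"
proof -
  have "nbhd (reports K (Mark ` D \<union> Probe ` F)) F - K =
      (\<Union>i<s. nbhd (report (E i) K (Mark ` D \<union> Probe ` F)) F - K)"
    by (simp add: reports_def nbhd_UN)
  also have "\<dots> = nbhd G F - K" by (simp add: nbhd_report G_def nbhd_UN)
  finally show ?thesis .
qed

lemma reports_single:
  assumes "{v, w} \<in> G" "w \<notin> K"
  shows "{v, w} \<in> reports K (Mark ` D \<union> Probe ` {v})"
proof -
  obtain i where "i < s" "{v, w} \<in> E i" using assms(1) by (auto simp: G_def)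
  then show ?thesis
    unfolding reports_def using report_single[OF _ assms(2), of v "E i" D] by (intro UN_I[of i]) simp_all
qed

text \<open>When several vertices are probed, a new vertex may have a parent with every player,
  hence the factor \<open>s\<close>.\<close>

lemma sum_card_report_le:
  "(\<Sum>i<s. card (report (E i) K (Mark ` D \<union> Probe ` F))) \<le> s * card (nbhd G F - K)"
proof -
  have "card (report (E i) K (Mark ` D \<union> Probe ` F)) \<le> card (nbhd G F - K)" if "i < s" for i
  proof -
    have "nbhd (E i) F \<subseteq> nbhd G F" using that by (intro nbhd_mono) (auto simp: G_def)
    then have "card (nbhd (E i) F - K) \<le> card (nbhd G F - K)"
      using finite_nbhd by (intro card_mono) auto
    then show ?thesis using card_report_le[OF E_edges[OF that], of K D F] by simp
  qed
  then show ?thesis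
    using sum_bounded_above[of "{..<s}" "\<lambda>i. card (report (E i) K (Mark ` D \<union> Probe ` F))"
        "card (nbhd G F - K)"] by simp
qed

text \<open>This is where edge disjointness is used: the answers cost no factor \<open>s\<close>.\<close>

lemma sum_card_report_single_le:
  "(\<Sum>i<s. card (report (E i) K (Mark ` D \<union> Probe ` {v}))) \<le> card (nbhd G {v} - K)"
proof -
  have "(\<Sum>i<s. card (report (E i) K (Mark ` D \<union> Probe ` {v}))) \<le>
      (\<Sum>i<s. card (nbhd (E i) {v} - K))"
    by (intro sum_mono card_report_le[where n = n] E_edges) simp
  also have "\<dots> = card (\<Union>i<s. nbhd (E i) {v} - K)"
  proof (rule card_UN_disjoint[symmetric])
    show "\<forall>i\<in>{..<s}. finite (nbhd (E i) {v} - K)"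
      using finite_subset[OF nbhd_bounded[OF E_edges]] by auto
    show "\<forall>i\<in>{..<s}. \<forall>j\<in>{..<s}. i \<noteq> j \<longrightarrow>
        (nbhd (E i) {v} - K) \<inter> (nbhd (E j) {v} - K) = {}"
      using E_disjoint by (fastforce simp: nbhd_def disjoint_family_on_def)
  qed simp
  also have "(\<Union>i<s. nbhd (E i) {v} - K) = nbhd G {v} - K"
    by (simp add: G_def nbhd_UN)
  finally show ?thesis .
qed

text \<open>Messages of this form contain no \<open>Reset\<close>, so the marks \<open>D\<close>
  extend the players' \<open>Kp\<close> to the coordinator's \<open>K\<close> before the answers are
  computed.\<close>

lemma guarantees_Bcast:
  assumes "D \<subseteq> {..<n}" "F \<subseteq> {..<n}" "Kp \<union> D = K"
    and cost: "s * (2 + L * (card D + card F))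
      + L * (\<Sum>i<s. card (report (E i) K (Mark ` D \<union> Probe ` F))) + b' \<le> b"
    and "guarantees E Q (f (reports K (Mark ` D \<union> Probe ` F))) K b'"
  shows "guarantees E Q (Bcast (Mark ` D \<union> Probe ` F) f) Kp b"
proof -
  let ?M = "Mark ` D \<union> Probe ` F"
  have fin: "finite D" "finite F" using assms(1,2) finite_subset by auto
  have "learn Kp ?M = K" using assms(3) by (auto simp: learn_def)
  moreover have "?M \<subseteq> ops n" using assms(1,2) by (auto simp: ops_def)
  moreover have "report (E i) K ?M \<subseteq> all_edges n" if "i < s" for i
    using report_subset E_edges[OF that] by blast
  moreover have "card ?M = card D + card F"
  proof -
    have "card (Mark ` D) = card D" "card (Probe ` F) = card F"
      by (auto intro!: card_image inj_onI)
    then show ?thesis using fin by (subst card_Un_disjoint) auto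
  qed
  ultimately show ?thesis
    using cost assms(5) unfolding guarantees.simps reports_def by metis
qed

text \<open>The invariant of the search after \<open>k\<close> layers. Each round finds a new vertex
  or empties the frontier, so \<open>F = {} \<or> n < card K + t\<close> says that the rounds
  suffice. An unreached vertex is charged \<open>3 * s * L\<close>: up to \<open>s * L\<close> for
  being reported and \<open>2 * s * L\<close> for being marked and probed; for those in
  \<open>F\<close> only the latter is still due.\<close>

lemma guarantees_grow:
  assumes "F \<subseteq> K" "K \<subseteq> {..<n}" "Kp \<union> F = K"
    and "K = ball_of G c k" "nbhd G (K - F) \<subseteq> K"
    and "\<And>j. j \<le> k \<Longrightarrow> ball_of G c j \<subseteq> ball_of H c j" "H \<subseteq> G"
    and "F = {} \<or> n < card K + t"
    and "\<And>H' K'. H \<subseteq> H' \<Longrightarrow> H' \<subseteq> G \<Longrightarrow> (\<And>j. ball_of G c j \<subseteq> ball_of H' c j) \<Longrightarrow>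
      guarantees E Q (g H') K' b"
    and "2 * s * t + 2 * s * L * card F + 3 * s * L * (n - card K) + b \<le> b0"
  shows "guarantees E Q (grow t F K H g) Kp b0"
  using assms
proof (induction t arbitrary: F K Kp H k b0)
  case 0
  have "card K \<le> n" using card_mono[OF _ 0(2)] by simp
  then have F: "F = {}" using 0(8) by auto
  have "ball_of G c j \<subseteq> ball_of H c j" for j
  proof (cases "j \<le> k")
    \<comment> \<open>With an empty frontier \<open>K\<close> is closed under neighbours, so the
      ball stops growing at radius \<open>k\<close>.\<close>
    case False
    then have "k \<le> j" by simp
    then have "ball_of G c j = ball_of G c k"
      by (induction j rule: dec_induct) (use 0(4,5) F in auto)
    then show ?thesis using 0(6)[of k] ball_of_le[OF \<open>k \<le> j\<close>, of H c] by auto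
  qed (rule 0(6))
  then have "guarantees E Q (g H) Kp b" using 0(7,9) by blast
  then show ?case using guarantees_mono 0(10) by (simp add: guarantees_mono)
next
  case (Suc t)
  let ?M = "Mark ` F \<union> Probe ` F"
  define A where "A = reports K ?M"
  define N where "N = nbhd A F - K"
  have N_eq: "N = nbhd G F - K" unfolding N_def A_def by (rule nbhd_reports)
  have N: "N \<subseteq> {..<n}" using N_eq nbhd_bounded[OF G_edges] by auto
  have fin: "finite K" "finite N" using Suc.prems(2) N finite_subset by auto
  have ball: "K \<union> N = ball_of G c (Suc k)"
  proof -
    have "nbhd G K = nbhd G (K - F) \<union> nbhd G F"
      using nbhd_Un[of G "K - F" F] Suc.prems(1) by (simp add: Un_absorb2)
    then show ?thesis using Suc.prems(4,5) N_eq by auto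
  qed
  have card: "card (K \<union> N) = card K + card N"
    using fin by (intro card_Un_disjoint) (auto simp: N_def)
  have "card (K \<union> N) \<le> n" using card_mono[of "{..<n}" "K \<union> N"] Suc.prems(2) N by simp
  \<comment> \<open>\<open>r\<close> counts the vertices still unreached after this round and
    replaces truncated subtraction in the arithmetic below.\<close>
  then obtain r where r: "n = card K + card N + r" using card by (metis le_Suc_ex)
  define b' where "b' = 2 * s * t + 2 * s * L * card N + 3 * s * L * r + b"
  have "guarantees E Q (grow t N (K \<union> N) (H \<union> A) g) K b'"
  proof (rule Suc.IH)
    show "nbhd G (K \<union> N - N) \<subseteq> K \<union> N"
    proof -
      have "K \<union> N - N = K" using N_eq by auto
      then show ?thesis using ball Suc.prems(4) by auto
    qed
    show "H \<union> A \<subseteq> G" using Suc.prems(7) reports_subset by (auto simp: A_def)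
    show "ball_of G c j \<subseteq> ball_of (H \<union> A) c j" if "j \<le> Suc k" for j
    proof (cases "j = Suc k")
      case False
      then show ?thesis using Suc.prems(6)[of j] ball_of_mono[of H "H \<union> A" c j] that by auto
    next
      case True
      have "K \<subseteq> ball_of (H \<union> A) c k"
        using Suc.prems(4) Suc.prems(6)[of k] ball_of_mono[of H "H \<union> A" c k] by auto
      moreover have "N \<subseteq> nbhd (H \<union> A) K"
        unfolding N_def using nbhd_mono[of A "H \<union> A" F K] Suc.prems(1) by auto
      ultimately have "K \<union> N \<subseteq> ball_of (H \<union> A) c (Suc k)"
        using nbhd_mono[of "H \<union> A" "H \<union> A" K "ball_of (H \<union> A) c k"] by auto
      then show ?thesis using ball True by simp
    qed
    show "N = {} \<or> n < card (K \<union> N) + t"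
    proof (cases "N = {}")
      case False
      then have "F \<noteq> {}" using N_eq by (auto simp: nbhd_def)
      moreover have "0 < card N" using False fin by (simp add: card_gt_0_iff)
      ultimately show ?thesis using Suc.prems(8) card by auto
    qed simp
    show "guarantees E Q (g H') K' b"
      if "H \<union> A \<subseteq> H'" "H' \<subseteq> G" "\<And>j. ball_of G c j \<subseteq> ball_of H' c j" for H' K'
      by (rule Suc.prems(9)[OF _ that(2,3)]) (use that(1) in blast)
    show "2 * s * t + 2 * s * L * card N + 3 * s * L * (n - card (K \<union> N)) + b \<le> b'"
      unfolding b'_def card using r by simp
  qed (use ball Suc.prems(2) N in auto)
  moreover have "s * (2 + L * (card F + card F)) + L * (\<Sum>i<s. card (report (E i) K ?M)) + b' \<le> b0"
  proof -
    have "L * (\<Sum>i<s. card (report (E i) K ?M)) \<le> L * (s * card N)"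
      unfolding N_eq by (intro mult_le_mono2 sum_card_report_le)
    moreover have "n - card K = card N + r" using r by simp
    moreover have "s * (2 + L * (card F + card F)) + L * (s * card N) + b' \<le> b0"
      using Suc.prems(10) calculation(2) by (simp add: b'_def algebra_simps)
    ultimately show ?thesis by linarith
  qed
  ultimately show ?case
    unfolding grow.simps using Suc.prems(1-3)
    by (intro guarantees_Bcast[of F F Kp K b' b0]) (auto simp: A_def N_def)
qed

text \<open>The first summand pays for the \<open>Reset\<close> round; the rest is the budget of
  \<open>guarantees_grow\<close> for \<open>n\<close> rounds started at a single vertex, rounded
  up.\<close>

definition tree_cost :: nat where
  "tree_cost = s * (2 + L) + (2 * s * n + 2 * s * L + 3 * s * L * n)"

text \<open>Edges are only ever added, so trees grown earlier survive by monotonicity of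
  balls.\<close>

lemma guarantees_trees:
  assumes "set cs \<subseteq> {..<n}" "H \<subseteq> G"
    and "\<And>H'. H \<subseteq> H' \<Longrightarrow> H' \<subseteq> G \<Longrightarrow>
      (\<And>c j. c \<in> set cs \<Longrightarrow> ball_of G c j \<subseteq> ball_of H' c j) \<Longrightarrow> Q H'"
  shows "guarantees E Q (trees n cs H) Kp (length cs * tree_cost)"
  using assms
proof (induction cs arbitrary: H Kp)
  case Nil
  then show ?case by simp
next
  case (Cons c cs)
  let ?b = "length cs * tree_cost"
  define b1 where "b1 = (2 * s * n + 2 * s * L + 3 * s * L * n) + ?b"
  have "guarantees E Q (grow n {c} {c} H (trees n cs)) {} b1"
  \<comment> \<open>The root alone is the ball of radius 0, and \<open>n\<close> rounds suffice
    because \<open>n < 1 + n\<close>.\<close>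
  proof (rule guarantees_grow[where k = 0 and c = c])
    show "guarantees E Q (trees n cs H') K' ?b"
      if H': "H \<subseteq> H'" "H' \<subseteq> G" "\<And>j. ball_of G c j \<subseteq> ball_of H' c j" for H' K'
    proof (rule Cons.IH[OF _ H'(2)])
      fix H''
      assume H'': "H' \<subseteq> H''" "H'' \<subseteq> G"
        "\<And>c j. c \<in> set cs \<Longrightarrow> ball_of G c j \<subseteq> ball_of H'' c j"
      show "Q H''"
      proof (rule Cons.prems(3)[OF order_trans[OF H'(1) H''(1)] H''(2)])
        fix c' j assume "c' \<in> set (c # cs)"
        then show "ball_of G c' j \<subseteq> ball_of H'' c' j"
          using H'(3)[of j] H''(3)[of c' j] ball_of_mono[OF H''(1), of c j] by auto
      qed
    qed (use Cons.prems(1) in auto)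
    have "3 * s * L * (n - card {c}) \<le> 3 * s * L * n" by (intro mult_le_mono2) simp
    then show "2 * s * n + 2 * s * L * card {c} + 3 * s * L * (n - card {c}) + ?b \<le> b1"
      unfolding b1_def by simp
  qed (use Cons.prems in \<open>auto simp: nbhd_def\<close>)
  moreover have "s * (2 + L * card {Reset}) + L * (\<Sum>i<s. card (report (E i) (learn Kp {Reset}) {Reset}))
      + b1 \<le> length (c # cs) * tree_cost"
    by (simp add: report_Reset b1_def tree_cost_def algebra_simps)
  moreover have "learn Kp {Reset} = {}" by (simp add: learn_def)
  moreover have "{Reset} \<subseteq> ops n" by (simp add: ops_def)
  ultimately show ?case
    unfolding trees.simps guarantees.simps report_Reset by auto
qed

text \<open>Every centre covers at least \<open>d\<close> new vertices, which bounds the number of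
  trees by \<open>n div d\<close>. Each vertex still to be scanned has \<open>s * (2 + L)\<close>
  for its probe and \<open>L * d\<close> for answers if it does not become a centre. Each uncovered
  vertex holds \<open>(s + 1) * L\<close>: \<open>L\<close> for the answer that covers it and
  \<open>s * L\<close> for announcing it, which for \<open>D\<close> is still due.\<close>

lemma guarantees_scan:
  assumes "set vs \<subseteq> {..<n}" "K \<subseteq> {..<n}" "Kp \<union> D = K" "H \<subseteq> G" "set cs \<subseteq> {..<n}"
    and "\<And>w. w \<in> K \<Longrightarrow> \<exists>c\<in>set cs. {c, w} \<in> G"
    and "d * length cs \<le> card K"
    and "\<And>v w. v < n \<Longrightarrow> v \<notin> set vs \<Longrightarrow> {v, w} \<in> G \<Longrightarrow> w \<notin> K \<Longrightarrow> {v, w} \<in> H"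
    and "length vs * (s * (2 + L) + L * d) + s * L * card D + (s + 1) * L * (n - card K)
      + (n div d) * tree_cost \<le> b"
  shows "guarantees E (additive_spanner 2 n G) (scan n d vs D K cs H) Kp b"
  using assms
proof (induction vs arbitrary: D K Kp cs H b)
  case Nil
  have "card K \<le> n" using card_mono[OF _ Nil(2)] by simp
  then have "length cs \<le> n div d"
    using Nil(7) d_pos by (simp add: less_eq_div_iff_mult_less_eq mult.commute)
  then have "length cs * tree_cost \<le> b"
    using Nil(9) mult_le_mono1[of "length cs" "n div d" tree_cost]
    by linarith
  moreover have "guarantees E (additive_spanner 2 n G) (trees n cs H) Kp (length cs * tree_cost)"
  proof (rule guarantees_trees[OF Nil(5,4)])
    fix H' assume H': "H \<subseteq> H'" "H' \<subseteq> G"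
      "\<And>c j. c \<in> set cs \<Longrightarrow> ball_of G c j \<subseteq> ball_of H' c j"
    show "additive_spanner 2 n G H'"
    proof (rule spanner_from_centres[OF H'(2) G_edges _ Nil(6) H'(3)])
      fix v w assume vw: "{v, w} \<in> G" "w \<notin> K"
      then have "v < n" using G_edges by (auto simp: all_edges_def)
      then show "{v, w} \<in> H'" using Nil(8)[of v w] vw H'(1) by auto
    qed
  qed
  ultimately show ?case using guarantees_mono by auto
next
  case (Cons v vs)
  let ?M = "Mark ` D \<union> Probe ` {v}" and ?a = "s * (2 + L) + L * d"
  define A where "A = reports K ?M"
  define N where "N = nbhd A {v} - K"
  have N_eq: "N = nbhd G {v} - K" unfolding N_def A_def by (rule nbhd_reports)
  have N: "N \<subseteq> {..<n}" using N_eq nbhd_bounded[OF G_edges] by auto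
  have fin: "finite K" "finite N" using Cons.prems(2) N finite_subset by auto
  have card: "card (K \<union> N) = card K + card N"
    using fin by (intro card_Un_disjoint) (auto simp: N_def)
  have "card (K \<union> N) \<le> n" using card_mono[of "{..<n}" "K \<union> N"] Cons.prems(2) N by simp
  then obtain r where r: "n = card K + card N + r" using card by (metis le_Suc_ex)
  have HA: "H \<union> A \<subseteq> G" using Cons.prems(4) reports_subset by (auto simp: A_def)
  \<comment> \<open>The probe of \<open>v\<close> adds all its edges to uncovered vertices;
    \<open>K\<close> only grows, so the edges collected at earlier vertices stay sufficient.\<close>
  have sparse: "{u, w} \<in> H \<union> A" if "u < n" "u \<notin> set vs" "{u, w} \<in> G" "w \<notin> K" for u w
    using Cons.prems(8)[of u w] reports_single[of u w K D] that by (cases "u = v") (auto simp: A_def)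
  have cost: "s * (2 + L * (card D + card {v})) + L * (\<Sum>i<s. card (report (E i) K ?M))
      \<le> s * (2 + L) + s * L * card D + L * card N"
    using mult_le_mono2[OF sum_card_report_single_le[of K D v], of L] N_eq
    by (simp add: algebra_simps)
  have total: "length vs * ?a + ?a + s * L * card D + (s + 1) * L * (card N + r)
      + (n div d) * tree_cost \<le> b"
    using Cons.prems(9) r by (simp add: algebra_simps)
  have DK: "D \<subseteq> {..<n}" "{v} \<subseteq> {..<n}" using Cons.prems(1-3) by auto
  show ?case
  proof (cases "d \<le> card N")
    case True
    define b' where "b' = length vs * ?a + s * L * card N + (s + 1) * L * r + (n div d) * tree_cost"
    have "guarantees E (additive_spanner 2 n G) (scan n d vs N (K \<union> N) (v # cs) (H \<union> A)) K b'"
    proof (rule Cons.IH[OF _ _ _ HA])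
      show "\<exists>c\<in>set (v # cs). {c, w} \<in> G" if "w \<in> K \<union> N" for w
        using that Cons.prems(6)[of w] N_eq by (auto simp: nbhd_def)
      show "d * length (v # cs) \<le> card (K \<union> N)" using Cons.prems(7) True card by simp
      show "length vs * ?a + s * L * card N + (s + 1) * L * (n - card (K \<union> N))
          + (n div d) * tree_cost \<le> b'"
        unfolding b'_def card using r by simp
    qed (use Cons.prems(1,2,5) N sparse in auto)
    moreover have "s * (2 + L) + s * L * card D + L * card N + b' \<le> b"
      using total by (simp add: b'_def algebra_simps)
    then have "s * (2 + L * (card D + card {v})) + L * (\<Sum>i<s. card (report (E i) K ?M)) + b' \<le> b"
      using cost by linarith
    ultimately show ?thesis
      unfolding scan.simps using True
      by (intro guarantees_Bcast[OF DK Cons.prems(3), of b']) (auto simp: A_def N_def Let_def)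
  next
    case False
    define b' where "b' = length vs * ?a + (s + 1) * L * (card N + r) + (n div d) * tree_cost"
    have "guarantees E (additive_spanner 2 n G) (scan n d vs {} K cs (H \<union> A)) K b'"
    proof (rule Cons.IH[OF _ Cons.prems(2) _ HA Cons.prems(5,6,7)])
      show "length vs * ?a + s * L * card {} + (s + 1) * L * (n - card K)
          + (n div d) * tree_cost \<le> b'"
        unfolding b'_def using r by simp
    qed (use Cons.prems(1) sparse in auto)
    moreover have "L * card N \<le> L * d" using False by simp
    then have "s * (2 + L * (card D + card {v})) + L * (\<Sum>i<s. card (report (E i) K ?M)) + b' \<le> b"
      using cost total unfolding b'_def by linarith
    ultimately show ?thesis
      unfolding scan.simps using False
      by (intro guarantees_Bcast[OF DK Cons.prems(3), of b']) (auto simp: A_def N_def Let_def)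
  qed
qed

end

section \<open>The total cost and the choice of parameters\<close>

definition protocol_cost :: "nat \<Rightarrow> nat \<Rightarrow> nat \<Rightarrow> nat \<Rightarrow> nat" where
  "protocol_cost n s L d = n * (s * (2 + L) + L * d) + (s + 1) * L * n
    + (n div d) * (s * (2 + L) + (2 * s * n + 2 * s * L + 3 * s * L * n))"

lemma card_all_edges_le: "card (all_edges n) \<le> n ^ 2"
proof -
  have "card (all_edges n) = n choose 2"
    unfolding all_edges_def using n_subsets[of "{..<n}" 2] by simp
  also have "\<dots> \<le> n * (n - 1)" by (simp add: choose_two)
  also have "\<dots> \<le> n ^ 2" by (simp add: power2_eq_square)
  finally show ?thesis .
qed

text \<open>One codeword length serves both alphabets: \<open>2 * n + 1\<close> bounds the number of
  operations and \<open>n ^ 2\<close> the number of edges.\<close>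

lemma spanner_cc_no_dup_le:
  assumes "0 < s" "0 < d" "0 < L" "n ^ 2 \<le> 2 ^ L" "2 * n + 1 \<le> 2 ^ L"
  shows "spanner_cc_no_dup 2 n s \<le> enat (protocol_cost n s L d)"
proof -
  have "card (Mark ` {..<n} \<union> Probe ` {..<n}) \<le> n + n"
    using card_Un_le[of "Mark ` {..<n}" "Probe ` {..<n}"]
      card_image_le[of "{..<n}" Mark] card_image_le[of "{..<n}" Probe] by simp
  then have "card (ops n) \<le> 2 * n + 1"
    unfolding ops_def using card_Un_le[of "{Reset}" "Mark ` {..<n} \<union> Probe ` {..<n}"]
    by (simp add: Un_assoc)
  then have "card (ops n) \<le> 2 ^ L" using assms(5) by (rule order_trans)
  moreover have "finite (ops n)" by (simp add: ops_def)
  ultimately obtain encm :: "op set \<Rightarrow> bool list" where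
    encm: "inj_on encm (Pow (ops n))" "\<And>A. encm A \<noteq> []"
      "\<And>A. A \<subseteq> ops n \<Longrightarrow> length (encm A) = 1 + L * card A"
    using set_encoding_exists[of "ops n" L] assms(3) by blast
  obtain enca :: "edges \<Rightarrow> bool list" where
    enca: "inj_on enca (Pow (all_edges n))" "\<And>A. enca A \<noteq> []"
      "\<And>A. A \<subseteq> all_edges n \<Longrightarrow> length (enca A) = 1 + L * card A"
    using set_encoding_exists[OF finite_all_edges, of n L] card_all_edges_le[of n] assms(3,4)
    by (metis order_trans)
  interpret broadcast s L "ops n" "all_edges n" encm enca learn "{}" report
    by unfold_locales (use assms(1) encm enca in auto)
  show ?thesis
    unfolding spanner_cc_no_dup_def
  proof (rule randomized_cc_le)
    fix E assume E: "E \<in> no_dup_inputs n s"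
    \<comment> \<open>Only the analysis depends on the input \<open>E\<close>; the program below
      does not mention it.\<close>
    interpret spanner_protocol s L n encm enca E d
      by unfold_locales (use E assms(2) in \<open>auto simp: no_dup_inputs_def\<close>)
    \<comment> \<open>For \<open>vs = [0..<n]\<close> and empty \<open>D\<close> and
      \<open>K\<close> the budget of \<open>guarantees_scan\<close> is exactly
      \<open>protocol_cost\<close>.\<close>
    have "guarantees E (additive_spanner 2 n G) (scan n d [0..<n] {} {} [] {}) {}
        (protocol_cost n s L d)"
      by (rule guarantees_scan) (auto simp: protocol_cost_def tree_cost_def)
    then show "guarantees E (additive_spanner 2 n (\<Union>i<s. E i)) (scan n d [0..<n] {} {} [] {}) {}
        (protocol_cost n s L d)"
      by (simp add: G_def)
  qed
qed

text \<open>Lower-order terms are absorbed since \<open>L\<close>, \<open>s\<close> and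
  \<open>n\<close> are at least 1. The constant 5 is 3 from the probe rounds plus 2 from the covered
  vertices; 10 comes from the trees.\<close>

lemma protocol_cost_le:
  assumes "1 \<le> L" "1 \<le> s" "0 < d" "1 \<le> n"
  shows "real (protocol_cost n s L d) \<le>
    real L * (5 * (real s * real n) + real n * real d + 10 * (real s * real n ^ 2 / real d))"
proof -
  have sL: "s \<le> s * L" "L \<le> s * L" "s \<le> s * L * n" "s * n \<le> s * L * n" "s * L \<le> s * L * n"
    using assms by auto
  have "s * (2 + L) \<le> 3 * (s * L)"
    using sL(1) unfolding distrib_left by linarith
  then have "n * (s * (2 + L) + L * d) \<le> n * (3 * (s * L) + L * d)"
    by (intro mult_le_mono2 add_le_mono1)
  moreover have "(s + 1) * L \<le> 2 * (s * L)"
    using sL(2) unfolding distrib_right by linarith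
  then have "(s + 1) * L * n \<le> 2 * (s * L) * n"
    by (rule mult_le_mono1)
  \<comment> \<open>Each of the five products is at most its coefficient times
    \<open>s * L * n\<close>, and \<open>2 + 1 + 2 + 2 + 3 = 10\<close>.\<close>
  moreover have "s * (2 + L) + (2 * s * n + 2 * s * L + 3 * s * L * n) \<le> 10 * (s * L * n)"
    using sL(3-5) unfolding distrib_left mult.assoc by linarith
  then have "(n div d) * (s * (2 + L) + (2 * s * n + 2 * s * L + 3 * s * L * n))
      \<le> (n div d) * (10 * (s * L * n))"
    by (rule mult_le_mono2)
  ultimately have "protocol_cost n s L d \<le>
      n * (3 * (s * L) + L * d) + 2 * (s * L) * n + (n div d) * (10 * (s * L * n))"
    unfolding protocol_cost_def by linarith
  then have "real (protocol_cost n s L d) \<le>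
      real (n * (3 * (s * L) + L * d) + 2 * (s * L) * n + (n div d) * (10 * (s * L * n)))"
    using of_nat_le_iff by blast
  also have "\<dots> = real n * (3 * (real s * L) + real L * d) + 2 * (real s * L) * n
      + real (n div d) * (10 * (real s * L * n))"
    by simp
  also have "\<dots> \<le> real n * (3 * (real s * L) + real L * d) + 2 * (real s * L) * n
      + (real n / real d) * (10 * (real s * L * n))"
    by (intro add_left_mono mult_right_mono of_nat_div_le_of_nat) auto
  also have "\<dots> = real L * (5 * (real s * real n) + real n * real d
      + 10 * (real s * real n ^ 2 / real d))"
    by (simp add: algebra_simps power2_eq_square)
  finally show ?thesis .
qed

lemma code_length_exists:
  assumes "2 \<le> n"
  obtains L :: nat where "1 \<le> L" "n ^ 2 \<le> 2 ^ L" "2 * n + 1 \<le> 2 ^ L" "real L \<le> 8 * ln (real n)"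
proof -
  define l where "l = nat \<lceil>log 2 (real n)\<rceil>"
  have log: "0 \<le> log 2 (real n)" using assms by simp
  have "real n = 2 powr log 2 (real n)" using assms by simp
  also have "\<dots> \<le> 2 powr real l" using log by (intro powr_mono) (auto simp: l_def)
  finally have "real n \<le> real (2 ^ l)" by (simp add: powr_realpow)
  then have nl: "n \<le> 2 ^ l" using of_nat_le_iff by blast
  have "n ^ 2 \<le> (2 ^ l) ^ 2" using nl by (intro power_mono) auto
  then have sq: "2 * n ^ 2 \<le> 2 ^ (2 * l + 1)" by (simp add: power_mult[symmetric] mult.commute)
  have ln2: "2 / 3 \<le> ln (2 :: real)" by (rule ln2_ge_two_thirds)
  have lnn: "ln 2 \<le> ln (real n)" using assms by simp
  have "real l \<le> log 2 (real n) + 1" using log unfolding l_def by linarith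
  also have "log 2 (real n) = ln (real n) / ln 2" by (simp add: log_def)
  also have "\<dots> \<le> ln (real n) / (2 / 3)" using ln2 lnn by (intro divide_left_mono) auto
  finally have "real l \<le> 3 / 2 * ln (real n) + 1" by simp
  \<comment> \<open>The left side is at most \<open>3 * ln n + 3\<close>, and
    \<open>3 \<le> 9 / 2 * ln n\<close> because \<open>2 / 3 \<le> ln n\<close>.\<close>
  then have "real (2 * l + 1) \<le> 8 * ln (real n)" using ln2 lnn by simp
  moreover have "2 * n \<le> n ^ 2" using assms by (simp add: power2_eq_square)
  then have "2 * n + 1 \<le> 2 * n ^ 2" using assms by linarith
  ultimately show ?thesis using sq by (intro that[of "2 * l + 1"]) auto
qed

theorem theorem3p8:
  shows "\<exists>(C::real) (k::nat). \<forall>(n::nat) (s::nat). 2 \<le> n \<and> 1 \<le> s \<and> s \<le> n \<longrightarrow>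
    ereal_of_enat (spanner_cc_no_dup 2 n s)
      \<le> ereal (C * (sqrt (real s) * real n powr (3 / 2)) * ln (real n) ^ k)"
proof (rule exI[of _ 136], rule exI[of _ 1], intro allI impI)
  fix n s :: nat assume ns: "2 \<le> n \<and> 1 \<le> s \<and> s \<le> n"
  define q where "q = sqrt (real s * real n)"
  define T where "T = sqrt (real s) * real n powr (3 / 2)"
  \<comment> \<open>This threshold balances \<open>n * d\<close>, the cost of the answers to the
    scan, against \<open>s * n ^ 2 / d\<close>, the cost of the trees.\<close>
  define d where "d = nat \<lceil>q\<rceil>"
  obtain L :: nat where L: "1 \<le> L" "n ^ 2 \<le> 2 ^ L" "2 * n + 1 \<le> 2 ^ L" "real L \<le> 8 * ln (real n)"
    using code_length_exists ns by blast
  have "1 * 1 \<le> real s * real n" using ns by (intro mult_mono) auto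
  then have q1: "1 \<le> q" by (simp add: q_def)
  have dq: "q \<le> real d" "real d \<le> 2 * q" using q1 by (auto simp: d_def) linarith
  have T: "T = real n * q"
  proof -
    have "real n powr (3 / 2) = real n powr 1 * real n powr (1 / 2)"
      by (subst powr_add[symmetric]) simp
    then show ?thesis using ns by (simp add: T_def q_def powr_half_sqrt real_sqrt_mult)
  qed
  have qq: "q * q = real s * real n" by (simp add: q_def)
  \<comment> \<open>Here \<open>s \<le> n\<close> enters; it makes \<open>s * n = q * q\<close> at
    most \<open>n * q = T\<close>.\<close>
  have qn: "q \<le> real n"
  proof -
    have "q \<le> sqrt (real n * real n)"
      unfolding q_def using ns by (intro real_sqrt_le_mono mult_right_mono) auto
    then show ?thesis by simp
  qed
  have "real s * real n \<le> T" unfolding T qq[symmetric] using qn q1 by (intro mult_right_mono) auto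
  moreover have "real n * real d \<le> 2 * T"
    unfolding T using dq mult_left_mono[of "real d" "2 * q" "real n"] by simp
  moreover have "real s * real n ^ 2 / real d \<le> T"
  proof -
    have "real s * real n ^ 2 / real d = q * q * real n / real d"
      by (simp add: qq power2_eq_square)
    also have "\<dots> \<le> q * q * real n / q"
      using dq q1 by (intro divide_left_mono) auto
    also have "q * q * real n / q = T" using q1 by (simp add: T)
    finally show ?thesis .
  qed
  \<comment> \<open>\<open>17 = 5 + 2 + 10\<close>; together with the factor 8 from the codeword
    length this gives 136.\<close>
  ultimately have "5 * (real s * real n) + real n * real d + 10 * (real s * real n ^ 2 / real d) \<le> 17 * T"
    by linarith
  moreover have d0: "0 < d" using dq q1 by (cases d) auto
  ultimately have "real (protocol_cost n s L d) \<le> real L * (17 * T)"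
    using protocol_cost_le[of L s d n] L(1) ns
    by (meson mult_left_mono of_nat_0_le_iff order_trans one_le_numeral)
  also have "\<dots> \<le> 8 * ln (real n) * (17 * T)"
    using L(4) q1 by (intro mult_right_mono) (auto simp: T)
  finally have "real (protocol_cost n s L d) \<le> 136 * T * ln (real n) ^ 1" by (simp add: ac_simps)
  moreover have "ereal_of_enat (spanner_cc_no_dup 2 n s) \<le> ereal_of_enat (enat (protocol_cost n s L d))"
    unfolding ereal_of_enat_le_iff using ns d0 L by (intro spanner_cc_no_dup_le) auto
  ultimately show "ereal_of_enat (spanner_cc_no_dup 2 n s)
      \<le> ereal (136 * (sqrt (real s) * real n powr (3 / 2)) * ln (real n) ^ 1)"
    unfolding T_def[symmetric]
    by (metis ereal_less_eq(3) ereal_of_enat_simps(1) order_trans)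
qed

end
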